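(* Let $\mathcal{G}_1,\dots,\mathcal{G}_N$ be well-posed affine models with the polyhedral constraints described in the context, let $T\ge 1$ be the horizon, let $J$ be a given real-valued cost function of $u_T$, and let $\epsilon>0$ be a given separability index. The exact active model discrimination problem (defined in the context) is equivalent to the following bilevel optimization problem, i.e. the two problems have the same set of feasible input sequences $u_T$ and the same objective $J(u_T)$ (hence the same optimal values and optimal $u_T$). Outer problem: $$\min_{u_T} J(u_T)$$ subject to (a) $u(k)\in\mathcal{U}$ for all $k\in\{0,\dots,T-1\}$; (b) for all $1\le i<j\le N$ and all admissible uncertainties of the pair $(i,j)$ under $u_T$, the resulting trajectories satisfy $P_{x,i}x_i(k)\le p_{x,i}$ and $P_{x,j}x_j(k)\le p_{x,j}$ for all $k\in\{1,\dots,T\}$; (c) for every pair $\iota=(i,j)$ with $1\le i<j\le N$: $\delta^{\iota*}(u_T)\ge\epsilon$, where $\delta^{\iota*}(u_T)$ is the optimal value of the inner problem $$\delta^{\iota*}(u_T)=\min\ \delta^\iota$$ over $\delta^\iota\in\mathbb{R}$ and over all admissible uncertainties of the pair $\iota=(i,j)$ under $u_T$ (initial states, uncontrolled inputs, process noises and measurement noises of models $i$ and $j$), subject to $$|z_{i,l}(k)-z_{j,l}(k)|\le\delta^\iota\quad\text{for all } l\in\{1,\dots,p\},\ k\in\{0,\dots,T\},$$ where $z_{i,l}(k)$ and $z_{j,l}(k)$ are the $l$-th components of the resulting outputs $z_i(k),z_j(k)$ of models $i,j$.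
   Context: Models. There are $N\ge 2$ discrete-time affine models. Model $i$ has state $\vec{x}_i(k)=\begin{bmatrix} x_i(k) \\ y_i(k) \end{bmatrix}\in\mathbb{R}^n$ with $x_i(k)\in\mathbb{R}^{n_x}$, $y_i(k)\in\mathbb{R}^{n_y}$, $n=n_x+n_y$; input $\vec{u}_i(k)=\begin{bmatrix} u(k) \\ d_i(k) \end{bmatrix}\in\mathbb{R}^m$ with controlled input $u(k)\in\mathbb{R}^{m_u}$ common to all models and uncontrolled, model-dependent input $d_i(k)\in\mathbb{R}^{m_d}$, $m=m_u+m_d$; process noise $w_i(k)\in\mathbb{R}^{m_w}$; measurement noise $v_i(k)\in\mathbb{R}^{m_v}$; output $z_i(k)\in\mathbb{R}^p$. The dynamics are $$\vec{x}_i(k+1)=A_i\vec{x}_i(k)+B_i\vec{u}_i(k)+B_{w,i}w_i(k)+f_i,\qquad k=0,\dots,T-1,$$ $$z_i(k)=C_i\vec{x}_i(k)+D_i\vec{u}_i(k)+D_{v,i}v_i(k)+g_i,\qquad k=0,\dots,T.$$ Here $u_T=(u(0),\dots,u(T-1))$, $d_{i,T}=(d_i(0),\dots,d_i(T-1))$, $w_{i,T}=(w_i(0),\dots,w_i(T-1))$, $v_{i,T}=(v_i(0),\dots,v_i(T))$. Convention: since inputs are only defined up to time $T-1$, the term $D_i\vec{u}_i(T)$ is taken to be $0$ in the output equation at $k=T$. Constraint sets (all polyhedra given by finitely many inequalities; inequalities between vectors are componentwise): $\mathcal{X}_0=\{\vec{x}\in\mathbb{R}^n:P_0\vec{x}\le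 p_0\}$, $\mathcal{X}_{x,i}=\{x\in\mathbb{R}^{n_x}:P_{x,i}x\le p_{x,i}\}$, $\mathcal{X}_{y,i}=\{y\in\mathbb{R}^{n_y}:P_{y,i}y\le p_{y,i}\}$, $\mathcal{U}=\{u\in\mathbb{R}^{m_u}:Q_uu\le q_u\}$, $\mathcal{D}_i=\{d:Q_{d,i}d\le q_{d,i}\}$, $\mathcal{W}_i=\{w:Q_{w,i}w\le q_{w,i}\}$, $\mathcal{V}_i=\{v:Q_{v,i}v\le q_{v,i}\}$. Well-posedness. The models are well-posed if for each $i$: (1) for any initial state $\vec{x}_i(0)\in\mathcal{X}_0$ with $y_i(0)\in\mathcal{X}_{y,i}$, any $u(k)\in\mathcal{U}$ and any $w_i(k)\in\mathcal{W}_i$ ($k=0,\dots,T-1$), there exist $d_i(k)\in\mathcal{D}_i$, $k=0,\dots,T-1$, such that $y_i(k)\in\mathcal{X}_{y,i}$ for $k=1,\dots,T$; and (2) similarly, the constraint $x_i(k)\in\mathcal{X}_{x,i}$, $k=1,\dots,T$, can be satisfied by a choice of $u(k)\in\mathcal{U}$ for any uncertainties. Admissible uncertainties. Given $u_T$ and a pair $(i,j)$ with $i<j$, an admissible uncertainty of the pair under $u_T$ is a choice, for each $h\in\{i,j\}$, of $\vec{x}_h(0)\in\mathcal{X}_0$, $d_h(k)\in\mathcal{D}_h$ and $w_h(k)\in\mathcal{W}_h$ ($0\le k\le T-1$), $v_h(k)\in\mathcal{V}_h$ ($0\le k\le T$), such that the resulting trajectory satisfies $y_h(k)\in\mathcal{X}_{y,h}$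 for $1\le k\le T$. (The initial states of models $i$ and $j$ may differ.) Exact active model discrimination problem. Minimize $J(u_T)$ over $u_T$ subject to: $u(k)\in\mathcal{U}$ for all $k\in\{0,\dots,T-1\}$; and, for all $1\le i<j\le N$ and for all admissible uncertainties of the pair $(i,j)$ under $u_T$, both (i) $x_i(k')\in\mathcal{X}_{x,i}$ and $x_j(k')\in\mathcal{X}_{x,j}$ for all $k'\in\{1,\dots,T\}$, and (ii) there exists $k'\in\{0,\dots,T\}$ with $|z_i(k')-z_j(k')|\ge\epsilon$, where $|\cdot|$ denotes the maximum absolute value of the components (i.e. at least one output component differs by at least $\epsilon$). Convention: the minimum of the inner problem over an empty feasible set is $+\infty$. *)

theory Defs
  imports
    "Jordan_Normal_Form.Matrix"
    "HOL-Library.Extended_Real"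
    "HOL-Library.FuncSet"
begin

section \<open>Optimization problems\<close>

record ('a, 'b) opt_problem =
  feasible :: "'a set"
  objective :: "'a \<Rightarrow> 'b"

text \<open>The optimal value of a minimization problem is taken in the extended reals, so that it is
  \<open>\<infinity>\<close> when there is no feasible point.\<close>

definition optimal_value :: "('a, real) opt_problem \<Rightarrow> ereal" where
  "optimal_value Q = (INF a \<in> feasible Q. ereal (objective Q a))"

definition optimal_solutions :: "('a, real) opt_problem \<Rightarrow> 'a set" where
  "optimal_solutions Q = {a \<in> feasible Q. \<forall>b \<in> feasible Q. objective Q a \<le> objective Q b}"

section \<open>Affine models with polyhedral constraints\<close>

text \<open>The order on \<^typ>\<open>real vec\<close> is componentwise. The number of inequalities, i.e. of rows
  of \<open>P\<close>, is arbitrary.\<close>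

definition polyhedron :: "nat \<Rightarrow> real mat \<Rightarrow> real vec \<Rightarrow> real vec set" where
  "polyhedron n P q = {x \<in> carrier_vec n. P *\<^sub>v x \<le> q}"

definition wf_polyhedron :: "nat \<Rightarrow> real mat \<Rightarrow> real vec \<Rightarrow> bool" where
  "wf_polyhedron n P q \<longleftrightarrow> P \<in> carrier_mat (dim_vec q) n"

definition max_abs_vec :: "real vec \<Rightarrow> real" where
  "max_abs_vec v = Max (insert 0 {\<bar>v $ l\<bar> | l. l < dim_vec v})"

record affine_model =
  mat_A :: "real mat"
  mat_B :: "real mat"
  mat_Bw :: "real mat"
  vec_f :: "real vec"
  mat_C :: "real mat"
  mat_D :: "real mat"
  mat_Dv :: "real mat"
  vec_g :: "real vec"
  mat_Px :: "real mat"
  vec_px :: "real vec"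
  mat_Py :: "real mat"
  vec_py :: "real vec"
  mat_Qd :: "real mat"
  vec_qd :: "real vec"
  mat_Qw :: "real mat"
  vec_qw :: "real vec"
  mat_Qv :: "real mat"
  vec_qv :: "real vec"

text \<open>A family of models, indexed by \<open>{1..num_models}\<close>, with common dimensions and
  common constraints on the initial state and the controlled input.\<close>

record model_family =
  dim_x :: nat
  dim_y :: nat
  dim_u :: nat
  dim_d :: nat
  dim_w :: nat
  dim_v :: nat
  dim_z :: nat
  num_models :: nat
  model :: "nat \<Rightarrow> affine_model"
  mat_P0 :: "real mat"
  vec_p0 :: "real vec"
  mat_Qu :: "real mat"
  vec_qu :: "real vec"

definition wf_model :: "model_family \<Rightarrow> affine_model \<Rightarrow> bool" where
  "wf_model S M \<longleftrightarrow>
     (let n = dim_x S + dim_y S; m = dim_u S + dim_d S; p = dim_z S in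
        mat_A M \<in> carrier_mat n n \<and>
        mat_B M \<in> carrier_mat n m \<and>
        mat_Bw M \<in> carrier_mat n (dim_w S) \<and>
        vec_f M \<in> carrier_vec n \<and>
        mat_C M \<in> carrier_mat p n \<and>
        mat_D M \<in> carrier_mat p m \<and>
        mat_Dv M \<in> carrier_mat p (dim_v S) \<and>
        vec_g M \<in> carrier_vec p \<and>
        wf_polyhedron (dim_x S) (mat_Px M) (vec_px M) \<and>
        wf_polyhedron (dim_y S) (mat_Py M) (vec_py M) \<and>
        wf_polyhedron (dim_d S) (mat_Qd M) (vec_qd M) \<and>
        wf_polyhedron (dim_w S) (mat_Qw M) (vec_qw M) \<and>
        wf_polyhedron (dim_v S) (mat_Qv M) (vec_qv M))"

definition wf_family :: "model_family \<Rightarrow> bool" where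
  "wf_family S \<longleftrightarrow>
     num_models S \<ge> 2 \<and>
     wf_polyhedron (dim_x S + dim_y S) (mat_P0 S) (vec_p0 S) \<and>
     wf_polyhedron (dim_u S) (mat_Qu S) (vec_qu S) \<and>
     (\<forall>i \<in> {1..num_models S}. wf_model S (model S i))"

definition X0_set :: "model_family \<Rightarrow> real vec set" where
  "X0_set S = polyhedron (dim_x S + dim_y S) (mat_P0 S) (vec_p0 S)"

definition U_set :: "model_family \<Rightarrow> real vec set" where
  "U_set S = polyhedron (dim_u S) (mat_Qu S) (vec_qu S)"

definition Xx_set :: "model_family \<Rightarrow> affine_model \<Rightarrow> real vec set" where
  "Xx_set S M = polyhedron (dim_x S) (mat_Px M) (vec_px M)"

definition Xy_set :: "model_family \<Rightarrow> affine_model \<Rightarrow> real vec set" where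
  "Xy_set S M = polyhedron (dim_y S) (mat_Py M) (vec_py M)"

definition D_set :: "model_family \<Rightarrow> affine_model \<Rightarrow> real vec set" where
  "D_set S M = polyhedron (dim_d S) (mat_Qd M) (vec_qd M)"

definition W_set :: "model_family \<Rightarrow> affine_model \<Rightarrow> real vec set" where
  "W_set S M = polyhedron (dim_w S) (mat_Qw M) (vec_qw M)"

definition V_set :: "model_family \<Rightarrow> affine_model \<Rightarrow> real vec set" where
  "V_set S M = polyhedron (dim_v S) (mat_Qv M) (vec_qv M)"

section \<open>Trajectories\<close>

primrec state :: "affine_model \<Rightarrow> real vec \<Rightarrow> (nat \<Rightarrow> real vec) \<Rightarrow> (nat \<Rightarrow> real vec)
    \<Rightarrow> (nat \<Rightarrow> real vec) \<Rightarrow> nat \<Rightarrow> real vec" where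
  "state M x0 u d w 0 = x0"
| "state M x0 u d w (Suc k) =
     mat_A M *\<^sub>v state M x0 u d w k + mat_B M *\<^sub>v (u k @\<^sub>v d k) + mat_Bw M *\<^sub>v w k + vec_f M"

definition x_part :: "model_family \<Rightarrow> real vec \<Rightarrow> real vec" where
  "x_part S s = vec_first s (dim_x S)"

definition y_part :: "model_family \<Rightarrow> real vec \<Rightarrow> real vec" where
  "y_part S s = vec_last s (dim_y S)"

record uncertainty =
  initial :: "real vec"
  unc_input :: "nat \<Rightarrow> real vec"
  proc_noise :: "nat \<Rightarrow> real vec"
  meas_noise :: "nat \<Rightarrow> real vec"

definition traj :: "affine_model \<Rightarrow> (nat \<Rightarrow> real vec) \<Rightarrow> uncertainty \<Rightarrow> nat \<Rightarrow> real vec" where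
  "traj M u \<xi> = state M (initial \<xi>) u (unc_input \<xi>) (proc_noise \<xi>)"

text \<open>Inputs are only defined before time \<open>T\<close>; the feedthrough term is \<open>0\<close> at time \<open>T\<close>.\<close>

definition out :: "nat \<Rightarrow> affine_model \<Rightarrow> (nat \<Rightarrow> real vec) \<Rightarrow> uncertainty \<Rightarrow> nat \<Rightarrow> real vec" where
  "out T M u \<xi> k =
     mat_C M *\<^sub>v traj M u \<xi> k
     + (if k < T then mat_D M *\<^sub>v (u k @\<^sub>v unc_input \<xi> k) else 0\<^sub>v (dim_row (mat_D M)))
     + mat_Dv M *\<^sub>v meas_noise \<xi> k + vec_g M"

definition well_posed_model :: "model_family \<Rightarrow> nat \<Rightarrow> affine_model \<Rightarrow> bool" where
  "well_posed_model S T M \<longleftrightarrow>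
     (\<forall>x0 u w.
        x0 \<in> X0_set S \<longrightarrow> y_part S x0 \<in> Xy_set S M \<longrightarrow>
        (\<forall>k<T. u k \<in> U_set S) \<longrightarrow> (\<forall>k<T. w k \<in> W_set S M) \<longrightarrow>
        (\<exists>d. (\<forall>k<T. d k \<in> D_set S M) \<and>
             (\<forall>k \<in> {1..T}. y_part S (state M x0 u d w k) \<in> Xy_set S M))) \<and>
     (\<forall>x0 d w.
        x0 \<in> X0_set S \<longrightarrow> y_part S x0 \<in> Xy_set S M \<longrightarrow>
        (\<forall>k<T. d k \<in> D_set S M) \<longrightarrow> (\<forall>k<T. w k \<in> W_set S M) \<longrightarrow>
        (\<exists>u. (\<forall>k<T. u k \<in> U_set S) \<and>
             (\<forall>k \<in> {1..T}. x_part S (state M x0 u d w k) \<in> Xx_set S M)))"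

definition well_posed :: "model_family \<Rightarrow> nat \<Rightarrow> bool" where
  "well_posed S T \<longleftrightarrow> (\<forall>i \<in> {1..num_models S}. well_posed_model S T (model S i))"

definition admissible :: "model_family \<Rightarrow> nat \<Rightarrow> affine_model \<Rightarrow> (nat \<Rightarrow> real vec) \<Rightarrow> uncertainty set" where
  "admissible S T M u =
     {\<xi>. initial \<xi> \<in> X0_set S \<and>
         (\<forall>k<T. unc_input \<xi> k \<in> D_set S M) \<and>
         (\<forall>k<T. proc_noise \<xi> k \<in> W_set S M) \<and>
         (\<forall>k\<le>T. meas_noise \<xi> k \<in> V_set S M) \<and>
         (\<forall>k \<in> {1..T}. y_part S (traj M u \<xi> k) \<in> Xy_set S M)}"

definition admissible_pair :: "model_family \<Rightarrow> nat \<Rightarrow> nat \<Rightarrow> nat \<Rightarrow> (nat \<Rightarrow> real vec)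
    \<Rightarrow> (uncertainty \<times> uncertainty) set" where
  "admissible_pair S T i j u = admissible S T (model S i) u \<times> admissible S T (model S j) u"

section \<open>The two discrimination problems\<close>

text \<open>Input sequences of length \<open>T\<close> are extensional functions on \<open>{..<T}\<close>, so that two of them are
  equal iff they agree before time \<open>T\<close>.\<close>

definition input_seqs :: "model_family \<Rightarrow> nat \<Rightarrow> (nat \<Rightarrow> real vec) set" where
  "input_seqs S T = {..<T} \<rightarrow>\<^sub>E carrier_vec (dim_u S)"

definition exact_problem :: "model_family \<Rightarrow> nat \<Rightarrow> ((nat \<Rightarrow> real vec) \<Rightarrow> real) \<Rightarrow> real
    \<Rightarrow> (nat \<Rightarrow> real vec, real) opt_problem" where
  "exact_problem S T J \<epsilon> =
     \<lparr> feasible = {u \<in> input_seqs S T.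
         (\<forall>k<T. u k \<in> U_set S) \<and>
         (\<forall>i j. 1 \<le> i \<and> i < j \<and> j \<le> num_models S \<longrightarrow>
           (\<forall>(\<xi>, \<eta>) \<in> admissible_pair S T i j u.
             (\<forall>k \<in> {1..T}. x_part S (traj (model S i) u \<xi> k) \<in> Xx_set S (model S i) \<and>
                           x_part S (traj (model S j) u \<eta> k) \<in> Xx_set S (model S j)) \<and>
             (\<exists>k\<le>T. max_abs_vec (out T (model S i) u \<xi> k - out T (model S j) u \<eta> k) \<ge> \<epsilon>)))},
       objective = J \<rparr>"

definition inner_problem :: "model_family \<Rightarrow> nat \<Rightarrow> nat \<Rightarrow> nat \<Rightarrow> (nat \<Rightarrow> real vec)
    \<Rightarrow> (real \<times> uncertainty \<times> uncertainty, real) opt_problem" where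
  "inner_problem S T i j u =
     \<lparr> feasible = {(\<delta>, \<xi>, \<eta>).
         (\<xi>, \<eta>) \<in> admissible_pair S T i j u \<and>
         (\<forall>l < dim_z S. \<forall>k\<le>T.
           \<bar>out T (model S i) u \<xi> k $ l - out T (model S j) u \<eta> k $ l\<bar> \<le> \<delta>)},
       objective = (\<lambda>(\<delta>, \<xi>, \<eta>). \<delta>) \<rparr>"

definition bilevel_problem :: "model_family \<Rightarrow> nat \<Rightarrow> ((nat \<Rightarrow> real vec) \<Rightarrow> real) \<Rightarrow> real
    \<Rightarrow> (nat \<Rightarrow> real vec, real) opt_problem" where
  "bilevel_problem S T J \<epsilon> =
     \<lparr> feasible = {u \<in> input_seqs S T.
         (\<forall>k<T. u k \<in> U_set S) \<and>
         (\<forall>i j. 1 \<le> i \<and> i < j \<and> j \<le> num_models S \<longrightarrow>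
           (\<forall>(\<xi>, \<eta>) \<in> admissible_pair S T i j u. \<forall>k \<in> {1..T}.
             mat_Px (model S i) *\<^sub>v x_part S (traj (model S i) u \<xi> k) \<le> vec_px (model S i) \<and>
             mat_Px (model S j) *\<^sub>v x_part S (traj (model S j) u \<eta> k) \<le> vec_px (model S j))) \<and>
         (\<forall>i j. 1 \<le> i \<and> i < j \<and> j \<le> num_models S \<longrightarrow>
           optimal_value (inner_problem S T i j u) \<ge> ereal \<epsilon>)},
       objective = J \<rparr>"

end

theory Submission
  imports Defs
begin

text \<open>
  The objectives agree, so everything reduces to the constraints on a given input sequence. The state
  constraints describe the same polyhedra, once as sets and once as inequalities. For the separation
  constraint, take a pair of models: a number \<open>\<delta>\<close> is feasible in the inner problem, together with
  given uncertainties, iff it bounds every output difference in every component and at every time.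
  If outputs have at least one component, the least such \<open>\<delta>\<close> is the largest output difference along
  the two trajectories, and the optimal value is at least \<open>\<epsilon>\<close> iff each admissible choice of
  uncertainties has some output difference of size at least \<open>\<epsilon>\<close>. This is
  \<open>inner_optimal_value_ge_iff\<close>.

  The argument only compares lower bounds, so it makes no difference whether the infimum over the
  uncertainties is attained. An infeasible inner problem has value \<open>\<infinity>\<close>, which matches the vacuous
  condition in the exact problem. If outputs have no components, \<open>\<delta>\<close> is unconstrained and, as \<open>\<epsilon>\<close> is
  positive, both formulations reject every input sequence under which some pair has an admissible
  uncertainty.
\<close>

lemma optimal_value_ge_iff:
  "ereal c \<le> optimal_value Q \<longleftrightarrow> (\<forall>a \<in> feasible Q. c \<le> objective Q a)"
  by (simp add: optimal_value_def le_INF_iff)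

text \<open>The value \<open>0\<close> that \<^const>\<open>max_abs_vec\<close> inserts into the maximum, so as to be defined on the
  empty vector, cannot be what reaches a positive threshold.\<close>

lemma max_abs_vec_ge_iff:
  assumes "c > 0"
  shows "c \<le> max_abs_vec v \<longleftrightarrow> (\<exists>l < dim_vec v. c \<le> \<bar>v $ l\<bar>)"
proof -
  have "finite (insert 0 {\<bar>v $ l\<bar> | l. l < dim_vec v})" by simp
  then show ?thesis
    using assms unfolding max_abs_vec_def by (subst Max_ge_iff) auto
qed

lemma dim_out [simp]: "dim_vec (out T M u \<xi> k) = dim_vec (vec_g M)"
  by (simp add: out_def)

lemma max_abs_out_diff_ge_iff:
  assumes "c > 0" "vec_g M \<in> carrier_vec p" "vec_g M' \<in> carrier_vec p"
  shows "c \<le> max_abs_vec (out T M u \<xi> k - out T M' u \<eta> k) \<longleftrightarrow>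
    (\<exists>l<p. c \<le> \<bar>out T M u \<xi> k $ l - out T M' u \<eta> k $ l\<bar>)"
  using assms by (auto simp: max_abs_vec_ge_iff)

lemma x_part_in_Xx_set_iff:
  "x_part S s \<in> Xx_set S M \<longleftrightarrow> mat_Px M *\<^sub>v x_part S s \<le> vec_px M"
  by (simp add: Xx_set_def polyhedron_def x_part_def)

text \<open>An output difference of size at least \<open>\<epsilon>\<close> forces \<open>\<delta> \<ge> \<epsilon>\<close>. Conversely, the largest output
  difference, or \<open>0\<close> if there are no components, is itself a feasible \<open>\<delta>\<close>. So if the optimal value is
  at least \<open>\<epsilon> > 0\<close>, that \<open>\<delta>\<close> is an output difference at some time and in some component.\<close>

lemma inner_optimal_value_ge_iff:
  assumes "\<epsilon> > 0"
    and "vec_g (model S i) \<in> carrier_vec (dim_z S)" "vec_g (model S j) \<in> carrier_vec (dim_z S)"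
  shows "ereal \<epsilon> \<le> optimal_value (inner_problem S T i j u) \<longleftrightarrow>
    (\<forall>(\<xi>, \<eta>) \<in> admissible_pair S T i j u.
      \<exists>k\<le>T. \<epsilon> \<le> max_abs_vec (out T (model S i) u \<xi> k - out T (model S j) u \<eta> k))"
    (is "?L \<longleftrightarrow> ?R")
proof
  assume R: ?R
  have "\<epsilon> \<le> \<delta>" if "(\<delta>, \<xi>, \<eta>) \<in> feasible (inner_problem S T i j u)" for \<delta> \<xi> \<eta>
  proof -
    have adm: "(\<xi>, \<eta>) \<in> admissible_pair S T i j u"
      and bound: "\<And>l k. l < dim_z S \<Longrightarrow> k \<le> T \<Longrightarrow>
        \<bar>out T (model S i) u \<xi> k $ l - out T (model S j) u \<eta> k $ l\<bar> \<le> \<delta>"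
      using that by (auto simp: inner_problem_def)
    from R adm obtain k where "k \<le> T"
      and "\<epsilon> \<le> max_abs_vec (out T (model S i) u \<xi> k - out T (model S j) u \<eta> k)"
      by blast
    then obtain l where "l < dim_z S"
      and "\<epsilon> \<le> \<bar>out T (model S i) u \<xi> k $ l - out T (model S j) u \<eta> k $ l\<bar>"
      using max_abs_out_diff_ge_iff[OF assms] by blast
    with bound[OF _ \<open>k \<le> T\<close>] show ?thesis by force
  qed
  then show ?L
    by (auto simp: optimal_value_ge_iff inner_problem_def)
next
  assume L: ?L
  have "\<exists>k\<le>T. \<epsilon> \<le> max_abs_vec (out T (model S i) u \<xi> k - out T (model S j) u \<eta> k)"
    if adm: "(\<xi>, \<eta>) \<in> admissible_pair S T i j u" for \<xi> \<eta>
  proof -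
    define diff where "diff = (\<lambda>(k, l). \<bar>out T (model S i) u \<xi> k $ l - out T (model S j) u \<eta> k $ l\<bar>)"
    define I where "I = {..T} \<times> {..<dim_z S}"
    \<comment> \<open>The inserted \<open>0\<close> makes the maximum exist for outputs without components.\<close>
    define \<delta> where "\<delta> = Max (insert 0 (diff ` I))"
    have fin: "finite (insert 0 (diff ` I))"
      by (simp add: I_def)
    have "diff (k, l) \<le> \<delta>" if "k \<le> T" "l < dim_z S" for k l
      unfolding \<delta>_def using fin that by (intro Max_ge) (auto simp: I_def)
    with adm have "(\<delta>, \<xi>, \<eta>) \<in> feasible (inner_problem S T i j u)"
      by (simp add: inner_problem_def diff_def)
    with L have "\<epsilon> \<le> \<delta>"
      by (auto simp: optimal_value_ge_iff inner_problem_def)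
    moreover have "\<delta> \<in> insert 0 (diff ` I)"
      unfolding \<delta>_def using fin by (intro Max_in) auto
    ultimately obtain k l where "k \<le> T" "l < dim_z S" "\<epsilon> \<le> diff (k, l)"
      using \<open>\<epsilon> > 0\<close> by (auto simp: I_def)
    then show ?thesis
      using max_abs_out_diff_ge_iff[OF assms] by (auto simp: diff_def)
  qed
  then show ?R by blast
qed

lemma feasible_exact_eq_bilevel:
  assumes wf: "wf_family S" and "\<epsilon> > 0"
  shows "feasible (exact_problem S T J \<epsilon>) = feasible (bilevel_problem S T J \<epsilon>)"
proof -
  have "vec_g (model S i) \<in> carrier_vec (dim_z S)" if "1 \<le> i" "i \<le> num_models S" for i
    using wf that by (auto simp: wf_family_def wf_model_def Let_def)
  then have inner: "ereal \<epsilon> \<le> optimal_value (inner_problem S T i j u) \<longleftrightarrow>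
      (\<forall>(\<xi>, \<eta>) \<in> admissible_pair S T i j u.
        \<exists>k\<le>T. \<epsilon> \<le> max_abs_vec (out T (model S i) u \<xi> k - out T (model S j) u \<eta> k))"
    if "1 \<le> i \<and> i < j \<and> j \<le> num_models S" for i j u
    using that \<open>\<epsilon> > 0\<close> by (intro inner_optimal_value_ge_iff) auto
  show ?thesis
    unfolding exact_problem_def bilevel_problem_def opt_problem.simps x_part_in_Xx_set_iff
  proof (intro Collect_cong conj_cong refl)
    fix u
    show "(\<forall>i j. 1 \<le> i \<and> i < j \<and> j \<le> num_models S \<longrightarrow>
        (\<forall>(\<xi>, \<eta>) \<in> admissible_pair S T i j u.
          (\<forall>k \<in> {1..T}.
            mat_Px (model S i) *\<^sub>v x_part S (traj (model S i) u \<xi> k) \<le> vec_px (model S i) \<and>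
            mat_Px (model S j) *\<^sub>v x_part S (traj (model S j) u \<eta> k) \<le> vec_px (model S j)) \<and>
          (\<exists>k\<le>T. \<epsilon> \<le> max_abs_vec (out T (model S i) u \<xi> k - out T (model S j) u \<eta> k)))) \<longleftrightarrow>
      (\<forall>i j. 1 \<le> i \<and> i < j \<and> j \<le> num_models S \<longrightarrow>
        (\<forall>(\<xi>, \<eta>) \<in> admissible_pair S T i j u. \<forall>k \<in> {1..T}.
          mat_Px (model S i) *\<^sub>v x_part S (traj (model S i) u \<xi> k) \<le> vec_px (model S i) \<and>
          mat_Px (model S j) *\<^sub>v x_part S (traj (model S j) u \<eta> k) \<le> vec_px (model S j))) \<and>
      (\<forall>i j. 1 \<le> i \<and> i < j \<and> j \<le> num_models S \<longrightarrow>
        ereal \<epsilon> \<le> optimal_value (inner_problem S T i j u))"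
      (is "(\<forall>i j. ?pair i j \<longrightarrow> (\<forall>(\<xi>, \<eta>) \<in> ?A i j. ?X i j \<xi> \<eta> \<and> ?Z i j \<xi> \<eta>)) \<longleftrightarrow> ?X' \<and> ?O")
    proof -
      have "?O \<longleftrightarrow> (\<forall>i j. ?pair i j \<longrightarrow> (\<forall>(\<xi>, \<eta>) \<in> ?A i j. ?Z i j \<xi> \<eta>))"
        using inner by simp
      then show ?thesis by blast
    qed
  qed
qed

theorem lemma1:
  fixes S :: model_family and T :: nat
    and J :: "(nat \<Rightarrow> real vec) \<Rightarrow> real" and \<epsilon> :: real
  assumes "wf_family S"
    and "T \<ge> 1"
    and "well_posed S T"
    and "\<epsilon> > 0"
  shows
    "feasible (exact_problem S T J \<epsilon>) = feasible (bilevel_problem S T J \<epsilon>) \<and>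
    objective (exact_problem S T J \<epsilon>) = objective (bilevel_problem S T J \<epsilon>) \<and>
    optimal_value (exact_problem S T J \<epsilon>) = optimal_value (bilevel_problem S T J \<epsilon>) \<and>
    optimal_solutions (exact_problem S T J \<epsilon>) = optimal_solutions (bilevel_problem S T J \<epsilon>)"
proof -
  have "feasible (exact_problem S T J \<epsilon>) = feasible (bilevel_problem S T J \<epsilon>)"
    by (rule feasible_exact_eq_bilevel[OF assms(1,4)])
  moreover have "objective (exact_problem S T J \<epsilon>) = objective (bilevel_problem S T J \<epsilon>)"
    by (simp add: exact_problem_def bilevel_problem_def)
  ultimately show ?thesis
    by (simp add: optimal_value_def optimal_solutions_def)
qed

end
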